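(* Consider a single-parameter domain with players $1,\dots,n$, allocation set $\mathcal{A}$ and publicly known nonempty sets $\mathcal{S}_1,\dots,\mathcal{S}_n\subseteq\mathcal{A}$, and let $M$ be a (possibly probabilistic) mechanism for this domain that is weakly dominant-strategy truthful in the classical setting. Then for every player $i$ and every nonempty candidate set $K_i\subseteq\Theta_i$, identifying $\Theta_i$ with $\mathbb{R}$ and writing $K_i^\perp=\inf K_i$ and $K_i^\top=\sup K_i$, every undominated strategy of $i$ lies between $K_i^\perp$ and $K_i^\top$: $$\mathsf{UD}_i(K_i)\subseteq\big[K_i^\perp,K_i^\top\big].$$ That is, every $v_i\in\mathsf{UD}_i(K_i)$ satisfies $K_i^\perp\le v_i\le K_i^\top$ (the corresponding inequality being vacuous if $K_i^\perp=-\infty$ or $K_i^\top=+\infty$).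
   Context: **Single-parameter domain.** There are $n$ players and a set $\mathcal{A}$ of possible allocations. For each player $i$ there is a publicly known nonempty subset $\mathcal{S}_i\subseteq\mathcal{A}$. The set $\Theta_i$ of possible valuations of player $i$ consists of all functions $\theta_i:\mathcal{A}\to\mathbb{R}$ such that (1) $\theta_i(x)=0$ for all $x\notin\mathcal{S}_i$, and (2) $\theta_i(x)=\theta_i(y)$ for all $x,y\in\mathcal{S}_i$. Each $\theta_i\in\Theta_i$ is identified with a single real number, namely its common value on $\mathcal{S}_i$; under this identification $\Theta_i=\mathbb{R}$, and order, infimum and supremum on $\Theta_i$ are those of $\mathbb{R}$. Write $\Theta_{-i}=\prod_{j\ne i}\Theta_j$. **Outcomes and utilities.** The set of outcomes is $\Omega=\mathcal{A}\times\mathbb{R}^n_{\ge 0}$; for $(A,P)\in\Omega$, $P_i$ is the price charged to player $i$. Utilities are quasi-linear: $U_i(\theta_i,(A,P))=\theta_i(A)-P_i$. If $\omega$ is a probability distribution over outcomes, $U_i(\theta_i,\omega)$ denotes the expected utility of player $i$ under $\omega$. **Mechanisms.** A mechanism $M$ specifies a set $S_i$ of pure strategies for each player $i$, and maps each strategy profile $s=(s_1,\dots,s_n)$ to an outcome $M(s)\in\Omega$, or, if $M$ is probabilistic, to a distribution $M(s)\in\Delta(\Omega)$ over outcomes. In the latter case $U_i(\theta_i,M(s))=\mathbb{E}_{\omega\sim M(s)}[U_i(\theta_i,\omega)]$, and for every profile $s$ the expected price of each player under $M(s)$ is assumed finite, so that expected utilities are well defined. Mixed strategies of $i$ are elements of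 $\Delta(S_i)$ (pure strategies being a special case). **Weakly dominant-strategy truthful (classical setting).** $M$ is weakly dominant-strategy truthful if for each player $i$: (0) $S_i=\Theta_i$; (1) for all $v_i,v_i'\in\Theta_i$ and all $v_{-i}\in\Theta_{-i}$: $U_i(v_i,M(v_i,v_{-i}))\ge U_i(v_i,M(v_i',v_{-i}))$; (2) for all $v_i\in\Theta_i$ and all $v_i'\in\Theta_i\setminus\{v_i\}$ there exists $v_{-i}\in\Theta_{-i}$ such that $U_i(v_i,M(v_i,v_{-i}))> U_i(v_i,M(v_i',v_{-i}))$. **Knightian valuation uncertainty.** Player $i$'s only information about the profile $\theta^*$ of true valuations is a candidate set $K_i\subseteq\Theta_i$ containing his true valuation $\theta_i^*$ (so $K_i$ is nonempty). **Undominated strategies.** Given $M$ and a candidate set $K_i$, a pure strategy $s_i\in S_i$ of player $i$ is (weakly) undominated, written $s_i\in\mathsf{UD}_i(K_i)$, if there is no other (possibly mixed) strategy $\sigma_i$ of $i$ such that both (1) for all $\theta_i\in K_i$ and all $s_{-i}\in S_{-i}$: $\mathbb{E}\,U_i(\theta_i,M(\sigma_i,s_{-i}))\ge U_i(\theta_i,M(s_i,s_{-i}))$, and (2) there exist $\theta_i\in K_i$ and $s_{-i}\in S_{-i}$ with $\mathbb{E}\,U_i(\theta_i,M(\sigma_i,s_{-i}))> U_i(\theta_i,M(s_i,s_{-i}))$, where $S_{-i}=\prod_{j\neq i}S_j$ and $\mathbb{E}$ is over the randomness of $\sigma_i$ (and of $M$). *)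

theory Defs
  imports "HOL-Probability.Probability"
begin

text \<open>
  Players are the elements of a finite type \<open>'i\<close>, allocations those of a type \<open>'a\<close>.
  The sets \<open>win i\<close> are the publicly known sets of the single-parameter domain (the calligraphic
  \<open>S_i\<close>), whereas \<open>S i\<close> is the set of pure strategies of player \<open>i\<close>.
\<close>

definition valuations :: "'a set \<Rightarrow> ('a \<Rightarrow> real) set" where
  "valuations W = {\<theta>. (\<forall>x. x \<notin> W \<longrightarrow> \<theta> x = 0) \<and> (\<forall>x\<in>W. \<forall>y\<in>W. \<theta> x = \<theta> y)}"

text \<open>The identification of a valuation with a real number; meaningful for \<open>W \<noteq> {}\<close>.\<close>

definition common_value :: "'a set \<Rightarrow> ('a \<Rightarrow> real) \<Rightarrow> real" where
  "common_value W \<theta> = (THE r. \<forall>x\<in>W. \<theta> x = r)"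

definition outcomes :: "('a \<times> (real ^ 'i)) set" where
  "outcomes = {(A, P). \<forall>i. 0 \<le> P $ i}"

text \<open>
  A distribution over outcomes may live on any sigma-algebra of outcomes for which the events
  ``the allocation lies in \<open>win i\<close>'' and the prices are measurable; this is what expected
  utilities need, and it covers discrete, continuous and degenerate distributions alike.
  Integrability expresses finiteness of the expected prices.
\<close>

definition outcome_dist :: "('i \<Rightarrow> 'a set) \<Rightarrow> ('a \<times> (real ^ 'i::finite)) measure \<Rightarrow> bool" where
  "outcome_dist win \<mu> \<longleftrightarrow>
     prob_space \<mu> \<and> space \<mu> = outcomes \<and>
     (\<forall>i. {\<omega> \<in> space \<mu>. fst \<omega> \<in> win i} \<in> sets \<mu>) \<and>
     (\<forall>i. integrable \<mu> (\<lambda>\<omega>. snd \<omega> $ i))"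

definition utility :: "'i \<Rightarrow> ('a \<Rightarrow> real) \<Rightarrow> 'a \<times> (real ^ 'i) \<Rightarrow> real" where
  "utility i \<theta> \<omega> = \<theta> (fst \<omega>) - snd \<omega> $ i"

definition exp_utility :: "'i \<Rightarrow> ('a \<Rightarrow> real) \<Rightarrow> ('a \<times> (real ^ 'i)) measure \<Rightarrow> real" where
  "exp_utility i \<theta> \<mu> = (\<integral>\<omega>. utility i \<theta> \<omega> \<partial>\<mu>)"

text \<open>Deterministic mechanisms are covered through point masses:\<close>

lemma outcome_dist_return:
  assumes "\<omega> \<in> outcomes"
  shows "outcome_dist win (return (count_space outcomes) \<omega>)"
    and "exp_utility i \<theta> (return (count_space outcomes) \<omega>) = utility i \<theta> \<omega>"
proof -
  have "integrable (return (count_space outcomes) \<omega>) f" for f :: "_ \<Rightarrow> real"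
    by (subst integrable_cong_AE[of _ _ "\<lambda>_. f \<omega>"])
      (use assms in \<open>auto simp: AE_return prob_space_return
         intro!: prob_space.finite_measure finite_measure.integrable_const\<close>)
  then show "outcome_dist win (return (count_space outcomes) \<omega>)"
    using assms by (auto simp: outcome_dist_def prob_space_return)
  show "exp_utility i \<theta> (return (count_space outcomes) \<omega>) = utility i \<theta> \<omega>"
    using assms by (simp add: exp_utility_def integral_return)
qed

definition mechanism ::
  "('i \<Rightarrow> 'a set) \<Rightarrow> ('i \<Rightarrow> 's set) \<Rightarrow> (('i \<Rightarrow> 's) \<Rightarrow> ('a \<times> (real ^ 'i::finite)) measure) \<Rightarrow> bool"
where
  "mechanism win S M \<longleftrightarrow> (\<forall>s \<in> Pi UNIV S. outcome_dist win (M s))"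

text \<open>
  A profile of the strategies of the players other than \<open>i\<close> is represented by a full profile
  whose \<open>i\<close>-th component is irrelevant, being overwritten in \<open>s(i := t)\<close>.
\<close>

definition others :: "'i \<Rightarrow> ('i \<Rightarrow> 's set) \<Rightarrow> ('i \<Rightarrow> 's) set" where
  "others i S = Pi (- {i}) S"

definition weakly_dst ::
  "('i \<Rightarrow> 'a set) \<Rightarrow> ('i \<Rightarrow> ('a \<Rightarrow> real) set) \<Rightarrow>
   (('i \<Rightarrow> 'a \<Rightarrow> real) \<Rightarrow> ('a \<times> (real ^ 'i::finite)) measure) \<Rightarrow> bool"
where
  "weakly_dst win S M \<longleftrightarrow>
     (\<forall>i. S i = valuations (win i)
        \<and> (\<forall>v \<in> valuations (win i). \<forall>v' \<in> valuations (win i).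
             \<forall>u \<in> others i (\<lambda>j. valuations (win j)).
               exp_utility i v (M (u(i := v))) \<ge> exp_utility i v (M (u(i := v'))))
        \<and> (\<forall>v \<in> valuations (win i). \<forall>v' \<in> valuations (win i) - {v}.
             \<exists>u \<in> others i (\<lambda>j. valuations (win j)).
               exp_utility i v (M (u(i := v))) > exp_utility i v (M (u(i := v')))))"

text \<open>
  A mixed strategy is a probability measure on \<open>S i\<close>, on any sigma-algebra for which the expected
  utilities are well defined. As utilities are bounded above for each \<open>\<theta>\<close>, a measure with
  measurable but non-integrable utility has expected utility \<open>-\<infinity>\<close> against some profile and hence
  could not dominate any strategy.
\<close>

definition mixed_strategy ::
  "('i \<Rightarrow> 'a set) \<Rightarrow> ('i \<Rightarrow> 's set) \<Rightarrow> (('i \<Rightarrow> 's) \<Rightarrow> ('a \<times> (real ^ 'i::finite)) measure) \<Rightarrow>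
   'i \<Rightarrow> 's measure \<Rightarrow> bool"
where
  "mixed_strategy win S M i \<sigma> \<longleftrightarrow>
     prob_space \<sigma> \<and> space \<sigma> = S i \<and>
     (\<forall>\<theta> \<in> valuations (win i). \<forall>u \<in> others i S.
        integrable \<sigma> (\<lambda>t. exp_utility i \<theta> (M (u(i := t)))))"

definition mixed_utility ::
  "(('i \<Rightarrow> 's) \<Rightarrow> ('a \<times> (real ^ 'i)) measure) \<Rightarrow> 'i \<Rightarrow> ('a \<Rightarrow> real) \<Rightarrow> 's measure \<Rightarrow>
   ('i \<Rightarrow> 's) \<Rightarrow> real"
where
  "mixed_utility M i \<theta> \<sigma> u = (\<integral>t. exp_utility i \<theta> (M (u(i := t))) \<partial>\<sigma>)"

text \<open>Pure strategies are mixed strategies:\<close>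

lemma mixed_strategy_return:
  assumes "t \<in> S i"
  shows "mixed_strategy win S M i (return (count_space (S i)) t)"
    and "mixed_utility M i \<theta> (return (count_space (S i)) t) u = exp_utility i \<theta> (M (u(i := t)))"
proof -
  have "integrable (return (count_space (S i)) t) f" for f :: "_ \<Rightarrow> real"
    by (subst integrable_cong_AE[of _ _ "\<lambda>_. f t"])
      (use assms in \<open>auto simp: AE_return prob_space_return
         intro!: prob_space.finite_measure finite_measure.integrable_const\<close>)
  then show "mixed_strategy win S M i (return (count_space (S i)) t)"
    using assms by (auto simp: mixed_strategy_def prob_space_return)
  show "mixed_utility M i \<theta> (return (count_space (S i)) t) u = exp_utility i \<theta> (M (u(i := t)))"
    using assms by (simp add: mixed_utility_def integral_return)
qed

text \<open>
  That the dominating strategy be different from \<open>t\<close> need not be required separately: it follows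
  from the strict inequality.
\<close>

definition undominated ::
  "('i \<Rightarrow> 'a set) \<Rightarrow> ('i \<Rightarrow> 's set) \<Rightarrow> (('i \<Rightarrow> 's) \<Rightarrow> ('a \<times> (real ^ 'i::finite)) measure) \<Rightarrow>
   'i \<Rightarrow> ('a \<Rightarrow> real) set \<Rightarrow> 's set"
where
  "undominated win S M i K =
     {t \<in> S i. \<not> (\<exists>\<sigma>. mixed_strategy win S M i \<sigma>
        \<and> (\<forall>\<theta> \<in> K. \<forall>u \<in> others i S.
             mixed_utility M i \<theta> \<sigma> u \<ge> exp_utility i \<theta> (M (u(i := t))))
        \<and> (\<exists>\<theta> \<in> K. \<exists>u \<in> others i S.
             mixed_utility M i \<theta> \<sigma> u > exp_utility i \<theta> (M (u(i := t)))))}"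

end

(*
  In a single-parameter domain the expected utility of a player of value r is the affine function
  r * p - q of r, where p is his winning probability and q his expected price. Reporting b rather
  than v is weakly better at the value b and weakly worse at the value v, so the gain is an affine
  function whose slope has the sign of b - v; it is therefore at least the gain at b for every
  value on the far side of b from v. If v lies outside the hull of the candidate set, any b
  strictly between v and that hull thus dominates v, strictly so against the profile for which
  truthfulness at b is strict.
*)
theory Submission
  imports Defs
begin

text \<open>For nonempty \<open>W\<close> this inverts \<open>common_value W\<close>, turning the
  identification of valuations with reals into explicit functions.\<close>

definition valuation_of :: "'a set \<Rightarrow> real \<Rightarrow> 'a \<Rightarrow> real" where
  "valuation_of W r = (\<lambda>x. if x \<in> W then r else 0)"

lemma valuation_of_in_valuations: "valuation_of W r \<in> valuations W"
  by (simp add: valuations_def valuation_of_def)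

lemma valuation_of_eq_iff: "W \<noteq> {} \<Longrightarrow> valuation_of W r = valuation_of W r' \<longleftrightarrow> r = r'"
  by (auto simp: valuation_of_def fun_eq_iff)

lemma valuation_of_common_value:
  assumes "W \<noteq> {}" and "\<theta> \<in> valuations W"
  shows "valuation_of W (common_value W \<theta>) = \<theta>"
proof -
  obtain x where x: "x \<in> W" using assms(1) by blast
  have const: "\<forall>y\<in>W. \<theta> y = \<theta> x" and zero: "\<And>y. y \<notin> W \<Longrightarrow> \<theta> y = 0"
    using x assms(2) unfolding valuations_def by blast+
  have "common_value W \<theta> = \<theta> x"
    unfolding common_value_def using const x by (intro the_equality) metis+
  then show ?thesis
    unfolding valuation_of_def using const zero by (intro ext) metis
qed

text \<open>The allocation enters the utility only through the event of lying in
  \<open>win i\<close>, so on the outcome space the valuation is \<open>r\<close> times an indicator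
  and the integral splits.\<close>

lemma exp_utility_valuation_of:
  assumes "outcome_dist win \<mu>"
  shows "exp_utility i (valuation_of (win i) r) \<mu> =
           r * measure \<mu> {\<omega> \<in> space \<mu>. fst \<omega> \<in> win i} - (\<integral>\<omega>. snd \<omega> $ i \<partial>\<mu>)"
proof -
  interpret prob_space \<mu> using assms by (simp add: outcome_dist_def)
  let ?E = "{\<omega> \<in> space \<mu>. fst \<omega> \<in> win i}"
  have E: "?E \<in> sets \<mu>" and P: "integrable \<mu> (\<lambda>\<omega>. snd \<omega> $ i)"
    using assms by (auto simp: outcome_dist_def)
  have I: "integrable \<mu> (\<lambda>\<omega>. r * indicat_real ?E \<omega>)"
    using E by (simp add: emeasure_eq_measure)
  have "exp_utility i (valuation_of (win i) r) \<mu> = (\<integral>\<omega>. r * indicat_real ?E \<omega> - snd \<omega> $ i \<partial>\<mu>)"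
    unfolding exp_utility_def utility_def
    by (intro Bochner_Integration.integral_cong) (auto simp: valuation_of_def indicator_def)
  also have "\<dots> = r * measure \<mu> ?E - (\<integral>\<omega>. snd \<omega> $ i \<partial>\<mu>)"
    using I P E by simp
  finally show ?thesis .
qed

text \<open>Adding the two truthfulness inequalities gives \<open>p - p'\<close> the weak sign of
  \<open>b - c\<close>. The two gains differ by \<open>(r - b) * (p - p')\<close>, and
  \<open>r - b\<close> has that weak sign too.\<close>

lemma affine_gain_ge:
  fixes b c r p p' q q' :: real
  assumes "b * p - q \<ge> b * p' - q'" and "c * p' - q' \<ge> c * p - q"
    and "(r - b) * (b - c) \<ge> 0" and "b \<noteq> c"
  shows "(r * p - q) - (r * p' - q') \<ge> (b * p - q) - (b * p' - q')"
proof -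
  have slope: "(b - c) * (p - p') \<ge> 0"
    using assms(1,2) by (simp add: algebra_simps)
  have "(r - b) * (p - p') \<ge> 0"
    using slope assms(3,4) by (auto simp: zero_le_mult_iff)
  then show ?thesis by (simp add: algebra_simps)
qed

text \<open>The product in the last hypothesis treats candidates above and below \<open>v\<close> at
  once: \<open>b\<close> lies between the value of \<open>v\<close> and each candidate
  value.\<close>

lemma not_undominated_if_separated:
  fixes win :: "'i::finite \<Rightarrow> 'a set"
  assumes win: "win i \<noteq> {}" and mech: "mechanism win S M" and dst: "weakly_dst win S M"
    and K: "K \<subseteq> valuations (win i)" "K \<noteq> {}"
    and v: "v \<in> valuations (win i)" and ne: "b \<noteq> common_value (win i) v"
    and sep: "\<And>\<theta>. \<theta> \<in> K \<Longrightarrow> (common_value (win i) \<theta> - b) * (b - common_value (win i) v) \<ge> 0"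
  shows "v \<notin> undominated win S M i K"
proof
  assume undom: "v \<in> undominated win S M i K"
  define c where "c = common_value (win i) v"
  have ne_c: "b \<noteq> c" using ne by (simp add: c_def)
  define w where "w = valuation_of (win i) b"
  let ?U = "\<lambda>\<theta> t u. exp_utility i \<theta> (M (u(i := t)))"
  have S: "S = (\<lambda>j. valuations (win j))"
    using dst by (auto simp: weakly_dst_def)
  have v_eq: "v = valuation_of (win i) c"
    using valuation_of_common_value[OF win v] by (simp add: c_def)
  have w: "w \<in> valuations (win i)"
    by (simp add: w_def valuation_of_in_valuations)
  have "v \<noteq> w"
    using ne_c unfolding v_eq w_def valuation_of_eq_iff[OF win] by simp
  have truth: "?U x x u \<ge> ?U x y u"
    if "x \<in> valuations (win i)" "y \<in> valuations (win i)" "u \<in> others i S" for x y u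
    using dst[unfolded weakly_dst_def, THEN spec, of i, THEN conjunct2, THEN conjunct1] that
    by (simp add: S)
  have gain: "?U \<theta> w u - ?U \<theta> v u \<ge> ?U w w u - ?U w v u"
    if \<theta>: "\<theta> \<in> K" and u: "u \<in> others i S" for \<theta> u
  proof -
    have dist: "outcome_dist win (M (u(i := t)))" if "t \<in> valuations (win i)" for t
      using mech u that by (auto simp: mechanism_def others_def S Pi_iff)
    \<comment> \<open>For fixed \<open>u\<close>, winning probability and expected price depend on
      the report \<open>t\<close> alone, not on the value \<open>r\<close>; this makes utility
      affine in \<open>r\<close>.\<close>
    define p where "p t = measure (M (u(i := t))) {\<omega> \<in> space (M (u(i := t))). fst \<omega> \<in> win i}" for t
    define q where "q t = (\<integral>\<omega>. snd \<omega> $ i \<partial>M (u(i := t)))" for t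
    have U: "?U (valuation_of (win i) r) t u = r * p t - q t" if "t \<in> valuations (win i)" for r t
      unfolding p_def q_def by (rule exp_utility_valuation_of[OF dist[OF that]])
    let ?r = "common_value (win i) \<theta>"
    have \<theta>_eq: "valuation_of (win i) ?r = \<theta>"
      using valuation_of_common_value[OF win] \<theta> K(1) by auto
    have "(b * p w - q w) \<ge> (b * p v - q v)"
      using truth[OF w v u] unfolding U[OF v, symmetric] U[OF w, symmetric] w_def[symmetric] .
    moreover have "(c * p v - q v) \<ge> (c * p w - q w)"
      using truth[OF v w u] unfolding U[OF v, symmetric] U[OF w, symmetric] v_eq[symmetric] .
    ultimately have "(?r * p w - q w) - (?r * p v - q v) \<ge> (b * p w - q w) - (b * p v - q v)"
      using sep[OF \<theta>, folded c_def] ne_c by (intro affine_gain_ge[of _ _ _ _ _ c])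
    then show ?thesis
      unfolding U[OF v, symmetric] U[OF w, symmetric] \<theta>_eq w_def[symmetric] .
  qed
  \<comment> \<open>The valuation \<open>w\<close> need not lie in \<open>K\<close>. Strictness
    holds at \<open>w\<close> against \<open>u\<close>, and \<open>gain\<close> carries it over to
    any member of \<open>K\<close>.\<close>
  obtain u where u: "u \<in> others i S" and strict: "?U w w u > ?U w v u"
    using dst w v \<open>v \<noteq> w\<close> unfolding S weakly_dst_def by blast
  obtain \<theta> where \<theta>: "\<theta> \<in> K" using K(2) by blast
  \<comment> \<open>The dominating strategy is pure: the point mass at the report
    \<open>w\<close>.\<close>
  let ?\<sigma> = "return (count_space (S i)) w"
  have wS: "w \<in> S i" using w by (simp add: S)
  note mixed = mixed_strategy_return[of w S i, OF wS]
  have "mixed_utility M i \<theta> ?\<sigma> u \<ge> ?U \<theta> v u" if "\<theta> \<in> K" "u \<in> others i S" for \<theta> u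
    using gain[OF that] truth[OF w v that(2)] unfolding mixed(2) by linarith
  moreover have "mixed_utility M i \<theta> ?\<sigma> u > ?U \<theta> v u"
    using gain[OF \<theta> u] strict unfolding mixed(2) by linarith
  ultimately show False
    using undom mixed(1)[of win M] \<theta> u unfolding undominated_def by blast
qed

theorem theorem1:
  fixes win :: "'i::finite \<Rightarrow> 'a set"
    and S :: "'i \<Rightarrow> ('a \<Rightarrow> real) set"
    and M :: "('i \<Rightarrow> 'a \<Rightarrow> real) \<Rightarrow> ('a \<times> (real ^ 'i)) measure"
    and i :: 'i
    and K :: "('a \<Rightarrow> real) set"
  assumes "\<And>j. win j \<noteq> {}"
    and "mechanism win S M"
    and "weakly_dst win S M"
    and "K \<subseteq> valuations (win i)"
    and "K \<noteq> {}"
  shows "(\<lambda>v. ereal (common_value (win i) v)) ` undominated win S M i K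
           \<subseteq> {(INF \<theta>\<in>K. ereal (common_value (win i) \<theta>)) .. (SUP \<theta>\<in>K. ereal (common_value (win i) \<theta>))}"
proof
  fix e assume "e \<in> (\<lambda>v. ereal (common_value (win i) v)) ` undominated win S M i K"
  then obtain v where undom: "v \<in> undominated win S M i K"
    and e: "e = ereal (common_value (win i) v)" by blast
  let ?c = "common_value (win i)"
  have v: "v \<in> valuations (win i)"
    using undom assms(3) by (auto simp: undominated_def weakly_dst_def)
  note dominated = not_undominated_if_separated[OF assms v]
  have "(INF \<theta>\<in>K. ereal (?c \<theta>)) \<le> e"
  proof (rule ccontr)
    assume "\<not> ?thesis"
    then have "e < (INF \<theta>\<in>K. ereal (?c \<theta>))" by (simp only: not_le)
    \<comment> \<open>A real \<open>b\<close> in the gap differs from the value of \<open>v\<close>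
      and stays below every candidate, so both factors of the separation product are
      positive.\<close>
    from ereal_dense2[OF this] obtain b where b: "e < ereal b" "ereal b < (INF \<theta>\<in>K. ereal (?c \<theta>))"
      by blast
    have "b < ?c \<theta>" if "\<theta> \<in> K" for \<theta>
      using less_le_trans[OF b(2) INF_lower[OF that]] by simp
    then show False
      using dominated[of b] undom b(1)[unfolded e]
      by (metis mult_nonneg_nonneg diff_ge_0_iff_ge less_imp_le less_ereal.simps(1) order_less_irrefl)
  qed
  moreover have "e \<le> (SUP \<theta>\<in>K. ereal (?c \<theta>))"
  proof (rule ccontr)
    assume "\<not> ?thesis"
    then have "(SUP \<theta>\<in>K. ereal (?c \<theta>)) < e" by (simp only: not_le)
    \<comment> \<open>Mirror case: \<open>b\<close> now exceeds every candidate and is below the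
      value of \<open>v\<close>, so both factors are negative and their product is again
      nonnegative.\<close>
    from ereal_dense2[OF this] obtain b where b: "(SUP \<theta>\<in>K. ereal (?c \<theta>)) < ereal b" "ereal b < e"
      by blast
    have "?c \<theta> < b" if "\<theta> \<in> K" for \<theta>
      using le_less_trans[OF SUP_upper[OF that] b(1)] by simp
    then show False
      using dominated[of b] undom b(2)[unfolded e]
      by (metis mult_nonpos_nonpos diff_le_0_iff_le less_imp_le less_ereal.simps(1) order_less_irrefl)
  qed
  ultimately show "e \<in> {(INF \<theta>\<in>K. ereal (?c \<theta>))..(SUP \<theta>\<in>K. ereal (?c \<theta>))}"
    by simp
qed

end
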